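(* Let $(O_1)$ and $(O_2)$ be the internal circles of an arbelos, with radii $R_1,R_2>0$, tangent to each other at $M$, let $(O)$ be its external circle, and fix one of the two open half-planes $H$ bounded by the line $O_1O_2$. Let the siblings be the circle $(S_1)$ of diameter $[O_1M]$ and the circle $(S_2)$ of diameter $[O_2M]$. Let $t_2$ be the tangent drawn from $O_1$ to the sibling $(S_2)$ whose point of contact $T_2$ lies in $H$, and let $t_1$ be the tangent drawn from $O_2$ to the sibling $(S_1)$ whose point of contact $T_1$ lies in $H$. Then the center of the twin $\omega_2$ is the pole of $t_2$ with respect to the circle $(O_2)$, and the center of the twin $\omega_1$ is the pole of $t_1$ with respect to the circle $(O_1)$.
   Context: Arbelos: $(O_1)$ and $(O_2)$ are circles with centers $O_1,O_2$ and radii $R_1,R_2>0$, externally tangent at the point $M$. The external circle $(O)$ has center $O$ on the line $O_1O_2$ and radius $R_1+R_2$, and is internally tangent to $(O_1)$ at $A_1$ and to $(O_2)$ at $A_2$, so that $A_1,O_1,M,O_2,A_2$ lie on one line in this order and $[A_1A_2]$ is a diameter of $(O)$. Let $l$ be the line through $M$ perpendicular to $O_1O_2$ (the common internal tangent of $(O_1)$ and $(O_2)$). Twins: for $i=1,2$, the twin $\omega_i$ is the circle with center in $H$, lying in the closed half-plane bounded by $l$ that contains $O_i$, which is tangent to $l$, externally tangent to $(O_i)$ and internally tangent to $(O)$. Pole: given a circle with center $\Omega$ and radius $\rho$ (the inversion circle) and a line $p$ not passing through $\Omega$, the pole of $p$ with respect to this circle is the inverse, with respect to the circle, of the orthogonal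 projection $P$ of $\Omega$ onto $p$; that is, the point $D$ on the ray $\Omega P$ with $\Omega P\cdot \Omega D=\rho^2$. *)

theory Defs
  imports "HOL-Analysis.Analysis"
begin

type_synonym point = "real ^ 2"

definition is_line :: "point set \<Rightarrow> bool" where
  "is_line L \<longleftrightarrow> (\<exists>a b. a \<noteq> b \<and> L = affine hull {a, b})"

definition perp_line :: "point \<Rightarrow> point \<Rightarrow> point \<Rightarrow> point set" where
  "perp_line M A B = {X. (X - M) \<bullet> (B - A) = 0}"

text \<open>The side is chosen by the sign of the normal vector \<open>n\<close>.\<close>

definition open_half_plane :: "point set \<Rightarrow> point set \<Rightarrow> bool" where
  "open_half_plane L H \<longleftrightarrow>
     (\<exists>n c. n \<noteq> 0 \<and> L = {X. n \<bullet> X = c} \<and> H = {X. n \<bullet> X > c})"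

definition closed_half_plane :: "point set \<Rightarrow> point set \<Rightarrow> bool" where
  "closed_half_plane L K \<longleftrightarrow>
     (\<exists>n c. n \<noteq> 0 \<and> L = {X. n \<bullet> X = c} \<and> K = {X. n \<bullet> X \<ge> c})"

text \<open>The circle with center \<open>c\<close> and radius \<open>r\<close> is \<open>sphere c r\<close>. The tangency
  predicates below are meant for positive radii.\<close>

definition line_tangent_at :: "point set \<Rightarrow> point \<Rightarrow> real \<Rightarrow> point \<Rightarrow> bool" where
  "line_tangent_at L c r T \<longleftrightarrow> is_line L \<and> L \<inter> sphere c r = {T}"

definition ext_tangent_at :: "point \<Rightarrow> real \<Rightarrow> point \<Rightarrow> real \<Rightarrow> point \<Rightarrow> bool" where
  "ext_tangent_at c r c' r' T \<longleftrightarrow>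
     sphere c r \<inter> sphere c' r' = {T} \<and> ball c r \<inter> ball c' r' = {}"

text \<open>In \<open>int_tangent_at c r c' r' T\<close> the first circle is the inner one.\<close>

definition int_tangent_at :: "point \<Rightarrow> real \<Rightarrow> point \<Rightarrow> real \<Rightarrow> point \<Rightarrow> bool" where
  "int_tangent_at c r c' r' T \<longleftrightarrow>
     sphere c r \<inter> sphere c' r' = {T} \<and> ball c r \<subseteq> ball c' r'"

text \<open>\<open>C\<close> is the center of the external circle. These conditions force the points
  \<open>A1\<close>, \<open>O1\<close>, \<open>M\<close>, \<open>O2\<close>, \<open>A2\<close> to lie on the line of centers in this order, and
  \<open>A1 A2\<close> to be a diameter of the external circle.\<close>

definition arbelos ::
  "point \<Rightarrow> real \<Rightarrow> point \<Rightarrow> real \<Rightarrow> point \<Rightarrow> point \<Rightarrow> point \<Rightarrow> point \<Rightarrow> bool" where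
  "arbelos O1 R1 O2 R2 M C A1 A2 \<longleftrightarrow>
     R1 > 0 \<and> R2 > 0 \<and>
     ext_tangent_at O1 R1 O2 R2 M \<and>
     C \<in> affine hull {O1, O2} \<and>
     int_tangent_at O1 R1 C (R1 + R2) A1 \<and>
     int_tangent_at O2 R2 C (R1 + R2) A2"

text \<open>The circle with center \<open>w\<close> and radius \<open>r\<close> is the twin, on the side \<open>H\<close>, at the
  internal circle with center \<open>Oi\<close> and radius \<open>Ri\<close>; \<open>l\<close> is the common internal tangent,
  \<open>C\<close> and \<open>R\<close> are the center and radius of the external circle.\<close>

definition is_twin ::
  "point set \<Rightarrow> point set \<Rightarrow> point \<Rightarrow> real \<Rightarrow> point \<Rightarrow> real \<Rightarrow> point \<Rightarrow> real \<Rightarrow> bool" where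
  "is_twin l H Oi Ri C R w r \<longleftrightarrow>
     r > 0 \<and> w \<in> H \<and>
     (\<exists>K. closed_half_plane l K \<and> Oi \<in> K \<and> sphere w r \<subseteq> K) \<and>
     (\<exists>T. line_tangent_at l w r T) \<and>
     (\<exists>T. ext_tangent_at w r Oi Ri T) \<and>
     (\<exists>T. int_tangent_at w r C R T)"

text \<open>Tangent at \<open>T\<close>, drawn from \<open>A\<close>, to the circle with diameter \<open>P Q\<close>.\<close>

definition tangent_from_to_diam_circle ::
  "point set \<Rightarrow> point \<Rightarrow> point \<Rightarrow> point \<Rightarrow> point \<Rightarrow> bool" where
  "tangent_from_to_diam_circle t A P Q T \<longleftrightarrow>
     A \<in> t \<and> line_tangent_at t (midpoint P Q) (dist P Q / 2) T"

text \<open>\<open>D\<close> is the pole of the line \<open>p\<close> with respect to the circle with center \<open>\<Omega>\<close> and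
  radius \<open>\<rho>\<close>; \<open>P\<close> is the orthogonal projection of \<open>\<Omega>\<close> onto \<open>p\<close>.\<close>

definition is_pole :: "point \<Rightarrow> real \<Rightarrow> point set \<Rightarrow> point \<Rightarrow> bool" where
  "is_pole \<Omega> \<rho> p D \<longleftrightarrow>
     is_line p \<and> \<Omega> \<notin> p \<and>
     (\<exists>P\<in>p. (\<forall>X\<in>p. (\<Omega> - P) \<bullet> (X - P) = 0) \<and>
        (\<exists>s\<ge>0. D = \<Omega> + s *\<^sub>R (P - \<Omega>)) \<and>
        dist \<Omega> P * dist \<Omega> D = \<rho>\<^sup>2)"

end

theory Submission
  imports Defs
begin

text \<open>
  Let \<open>S\<close> be the center of the sibling on the diameter \<open>O2 M\<close>, and \<open>T\<close> the contact
  point of the tangent \<open>t\<close> drawn to it from \<open>O1\<close>. The homothety with center \<open>O1\<close> that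
  takes \<open>S\<close> to \<open>O2\<close> takes \<open>T\<close> to a point \<open>P\<close> of \<open>t\<close>, and it takes the radius \<open>S T\<close>,
  which is perpendicular to \<open>t\<close>, to \<open>O2 P\<close>. So \<open>P\<close> is the projection of \<open>O2\<close> onto \<open>t\<close>,
  with \<open>P - O2 = k (T - S)\<close> and \<open>k = 2 (R1 + R2) / (2 R1 + R2)\<close>
  (lemma \<open>is_pole_by_homothety\<close>). It remains to see that the center \<open>w\<close> of the twin
  satisfies \<open>w - O2 = (4 / k) (T - S)\<close>: then \<open>w\<close> lies on the ray from \<open>O2\<close> to \<open>P\<close>, and
  the product of the two distances from \<open>O2\<close> is \<open>4 (R2 / 2)\<^sup>2 = R2\<^sup>2\<close>.

  This last equation is checked in the orthonormal frame at \<open>M\<close> with \<open>u\<close> pointing from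
  \<open>O1\<close> to \<open>O2\<close> and \<open>f\<close> pointing into the half-plane. The three tangencies of the twin
  determine its radius \<open>r = R1 R2 / (R1 + R2)\<close> and its center \<open>(r, y)\<close> with
  \<open>y\<^sup>2 = 4 r R2\<close> (lemma \<open>twin_coordinates\<close>); the tangency of \<open>t\<close> determines the first
  coordinate of \<open>T\<close> and the square of the second one (lemma
  \<open>sibling_contact_coordinates\<close>). The second coordinates can be compared through their
  squares because both points lie in the same half-plane, so both are positive.

  The two assertions of the theorem are the same one with the indices exchanged.
\<close>

section \<open>Tangency in metric terms\<close>

lemma ext_tangent_at_dist:
  assumes "ext_tangent_at c r c' r' T" "r > 0" "r' > 0"
  shows "dist c c' = r + r'"
proof (rule antisym)
  have T: "dist c T = r" "dist c' T = r'"
    using assms(1) by (auto simp: ext_tangent_at_def set_eq_iff)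
  show "dist c c' \<le> r + r'"
    using dist_triangle2[of c c' T] T by simp
  show "r + r' \<le> dist c c'"
  proof (rule ccontr)
    assume less: "\<not> r + r' \<le> dist c c'"
    \<comment> \<open>Otherwise the point that divides the segment of centers in the ratio of the radii
      would lie in both disks.\<close>
    define p where "p = c + (r / (r + r')) *\<^sub>R (c' - c)"
    have "c' - p = (1 - r / (r + r')) *\<^sub>R (c' - c)"
      by (simp add: p_def algebra_simps)
    also have "1 - r / (r + r') = r' / (r + r')"
      using assms by (simp add: field_simps)
    finally have "dist c' p = r' / (r + r') * dist c c'"
      using assms by (simp add: dist_norm norm_minus_commute)
    moreover have "dist c p = r / (r + r') * dist c c'"
      using assms by (simp add: p_def dist_norm norm_minus_commute)
    moreover have "s / (r + r') * dist c c' < s" if "s > 0" for s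
    proof -
      have "s * dist c c' < s * (r + r')"
        using less that by simp
      then show ?thesis
        using assms by (simp add: field_simps)
    qed
    ultimately have "p \<in> ball c r \<inter> ball c' r'"
      using assms by simp
    then show False
      using assms(1) by (auto simp: ext_tangent_at_def)
  qed
qed

lemma ext_tangent_at_contact:
  assumes "ext_tangent_at c r c' r' T" "r > 0" "r' > 0"
  shows "T = c + (r / (r + r')) *\<^sub>R (c' - c)"
proof -
  have T: "dist c T = r" "dist c' T = r'"
    using assms(1) by (auto simp: ext_tangent_at_def set_eq_iff)
  have "dist c c' = dist c T + dist T c'"
    using ext_tangent_at_dist[OF assms] T by (simp add: dist_commute)
  then have "norm (c - T) *\<^sub>R (T - c') = norm (T - c') *\<^sub>R (c - T)"
    by (simp add: dist_triangle_eq)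
  then have "r *\<^sub>R (T - c') = r' *\<^sub>R (c - T)"
    using T by (simp add: dist_norm norm_minus_commute)
  then have "(r + r') *\<^sub>R T = (r + r') *\<^sub>R c + r *\<^sub>R (c' - c)"
    by (simp add: algebra_simps)
  also have "\<dots> = (r + r') *\<^sub>R (c + (r / (r + r')) *\<^sub>R (c' - c))"
    using assms by (simp add: scaleR_add_right)
  finally show ?thesis
    using assms by (simp only: scaleR_cancel_left) simp
qed

lemma int_tangent_at_dist:
  assumes "int_tangent_at c r c' r' T" "r > 0"
  shows "dist c c' = r' - r"
proof -
  have T: "dist c T = r" "dist c' T = r'"
    using assms(1) by (auto simp: int_tangent_at_def set_eq_iff)
  have "dist c c' + r \<le> r'"
    using assms by (simp add: int_tangent_at_def ball_subset_ball_iff)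
  moreover have "r' \<le> dist c c' + r"
    using dist_triangle[of c' T c] T by (simp add: dist_commute)
  ultimately show ?thesis
    by simp
qed

lemma is_line_affine: "is_line L \<Longrightarrow> affine L"
  by (auto simp: is_line_def)

lemma affine_point_on_line:
  fixes A :: "'a::real_vector set"
  assumes "affine A" "p \<in> A" "q \<in> A"
  shows "p + s *\<^sub>R (q - p) \<in> A"
proof -
  have "(1 - s) *\<^sub>R p + s *\<^sub>R q \<in> A"
    using assms by (intro mem_affine) auto
  then show ?thesis
    by (simp add: algebra_simps)
qed

text \<open>The reflection of the contact point in the foot of the perpendicular from the
  center is again on the line and on the circle, so it is the contact point itself.\<close>

lemma line_tangent_at_perp:
  assumes "line_tangent_at L c r T" "X \<in> L"
  shows "(T - c) \<bullet> (X - T) = 0"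
proof (rule ccontr)
  assume neq: "(T - c) \<bullet> (X - T) \<noteq> 0"
  define v where "v = X - T"
  define s where "s = - 2 * ((T - c) \<bullet> v) / (v \<bullet> v)"
  have v: "v \<bullet> v \<noteq> 0"
    using neq by (auto simp: v_def)
  have T: "T \<in> L" "norm (T - c) = r"
    and only: "\<And>Y. Y \<in> L \<Longrightarrow> norm (Y - c) = r \<Longrightarrow> Y = T"
    using assms(1) by (auto simp: line_tangent_at_def set_eq_iff dist_norm norm_minus_commute)
  have "T + s *\<^sub>R v \<in> L"
    unfolding v_def using assms T is_line_affine
    by (intro affine_point_on_line) (auto simp: line_tangent_at_def)
  moreover have "(norm (T + s *\<^sub>R v - c))\<^sup>2 = (norm (T - c))\<^sup>2"
  proof -
    have "(norm (T + s *\<^sub>R v - c))\<^sup>2 = (norm ((T - c) + s *\<^sub>R v))\<^sup>2"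
      by (simp add: algebra_simps)
    also have "\<dots> = (norm (T - c))\<^sup>2 + s * (2 * ((T - c) \<bullet> v) + s * (v \<bullet> v))"
      unfolding power2_norm_eq_inner
      by (simp add: inner_add_left inner_add_right inner_commute algebra_simps)
    also have "2 * ((T - c) \<bullet> v) + s * (v \<bullet> v) = 0"
      using v by (simp add: s_def)
    finally show ?thesis
      by simp
  qed
  then have "norm (T + s *\<^sub>R v - c) = norm (T - c)"
    by (rule power2_eq_imp_eq) simp_all
  then have "norm (T + s *\<^sub>R v - c) = r"
    using T by simp
  ultimately have "T + s *\<^sub>R v = T"
    by (rule only)
  then show False
    using neq v by (auto simp: s_def v_def)
qed

section \<open>The arbelos in an orthonormal frame\<close>

lemma orthonormal_expansion_plane:
  fixes u f x :: "real ^ 2"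
  assumes "u \<bullet> u = 1" "f \<bullet> f = 1" "u \<bullet> f = 0"
  shows "x = (x \<bullet> u) *\<^sub>R u + (x \<bullet> f) *\<^sub>R f"
proof -
  define z where "z = x - (x \<bullet> u) *\<^sub>R u - (x \<bullet> f) *\<^sub>R f"
  have z: "z \<bullet> u = 0" "z \<bullet> f = 0"
    using assms by (simp_all add: z_def inner_diff_left inner_commute[of f u])
  have coords: "z$1 * u$1 + z$2 * u$2 = 0" "z$1 * f$1 + z$2 * f$2 = 0"
    "u$1 * u$1 + u$2 * u$2 = 1" "f$1 * f$1 + f$2 * f$2 = 1" "u$1 * f$1 + u$2 * f$2 = 0"
    using z assms by (simp_all add: inner_vec_def sum_2)
  define d where "d = u$1 * f$2 - u$2 * f$1"
  \<comment> \<open>Lagrange's identity: the determinant of an orthonormal pair has square \<open>1\<close>.\<close>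
  have "d * d = (u$1 * u$1 + u$2 * u$2) * (f$1 * f$1 + f$2 * f$2) - (u$1 * f$1 + u$2 * f$2)\<^sup>2"
    by (simp add: d_def power2_eq_square algebra_simps)
  then have "d \<noteq> 0"
    using coords by auto
  have "z$1 * d = (z$1 * u$1 + z$2 * u$2) * f$2 - (z$1 * f$1 + z$2 * f$2) * u$2"
    "z$2 * d = (z$1 * f$1 + z$2 * f$2) * u$1 - (z$1 * u$1 + z$2 * u$2) * f$1"
    by (simp_all add: d_def algebra_simps)
  then have "z$1 * d = 0" "z$2 * d = 0"
    by (simp_all add: coords(1,2))
  then have "z = 0"
    using \<open>d \<noteq> 0\<close> by (simp add: vec_eq_iff forall_2)
  then show ?thesis
    by (simp add: z_def algebra_simps)
qed

lemma arbelos_swap: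
  assumes "arbelos O1 R1 O2 R2 M C A1 A2"
  shows "arbelos O2 R2 O1 R1 M C A2 A1"
  using assms
  by (auto simp: arbelos_def ext_tangent_at_def insert_commute add.commute Int_commute)

text \<open>The two internal tangencies leave two candidates each for the position of \<open>C\<close> on
  the line of centers, and only one candidate is common to both.\<close>

lemma arbelos_axis:
  assumes "arbelos O1 R1 O2 R2 M C A1 A2"
  obtains u where "norm u = 1" "O1 = M - R1 *\<^sub>R u" "O2 = M + R2 *\<^sub>R u"
    "C = M + (R2 - R1) *\<^sub>R u"
proof -
  have R: "R1 > 0" "R2 > 0" and ext: "ext_tangent_at O1 R1 O2 R2 M"
    and C: "C \<in> affine hull {O1, O2}"
    and int: "int_tangent_at O1 R1 C (R1 + R2) A1" "int_tangent_at O2 R2 C (R1 + R2) A2"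
    using assms by (auto simp: arbelos_def)
  define u where "u = (1 / (R1 + R2)) *\<^sub>R (O2 - O1)"
  have O2: "O2 = O1 + (R1 + R2) *\<^sub>R u"
    using R by (simp add: u_def)
  have u: "norm u = 1"
    using ext_tangent_at_dist[OF ext R] R
    by (simp add: u_def dist_norm norm_minus_commute)
  have M: "M = O1 + R1 *\<^sub>R u"
    using ext_tangent_at_contact[OF ext R] by (simp add: u_def)
  obtain k where "C = O1 + k *\<^sub>R (O2 - O1)"
    using C by (auto simp: affine_hull_2_alt)
  then obtain c where c: "C = O1 + c *\<^sub>R u"
    by (metis O2 add_diff_cancel_left' scaleR_scaleR)
  have "dist O1 C = R2" "dist O2 C = R1"
    using int_tangent_at_dist[OF int(1)] int_tangent_at_dist[OF int(2)] R by auto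
  moreover have "dist O1 C = \<bar>c\<bar>"
    using u by (simp add: c dist_norm)
  moreover have "dist O2 C = \<bar>R1 + R2 - c\<bar>"
  proof -
    have "O2 - C = (R1 + R2 - c) *\<^sub>R u"
      by (simp add: O2 c algebra_simps)
    then show ?thesis
      using u by (simp add: dist_norm)
  qed
  ultimately have "c = R2"
    using R by auto
  then show thesis
    using that[of u] u O2 M c by (simp add: algebra_simps)
qed

lemma half_plane_normal:
  fixes O1 O2 M u :: point
  assumes H: "open_half_plane (affine hull {O1, O2}) H"
    and u: "norm u = 1" "O1 = M - R1 *\<^sub>R u" "O2 = M + R2 *\<^sub>R u" and R: "R1 > 0" "R2 > 0"
  obtains f where "f \<bullet> f = 1" "u \<bullet> f = 0" "\<And>X. X \<in> H \<Longrightarrow> (X - M) \<bullet> f > 0"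
proof -
  obtain n c where n: "n \<noteq> 0" and L: "affine hull {O1, O2} = {X. n \<bullet> X = c}"
    and Hc: "H = {X. n \<bullet> X > c}"
    using H by (auto simp: open_half_plane_def)
  have "O1 \<in> affine hull {O1, O2}" "O2 \<in> affine hull {O1, O2}"
    by (auto intro: hull_inc)
  then have nO: "n \<bullet> O1 = c" "n \<bullet> O2 = c"
    using L by auto
  then have "(R1 + R2) * (n \<bullet> u) = 0"
    using u by (simp add: inner_diff_right inner_add_right algebra_simps)
  then have nu: "n \<bullet> u = 0"
    using R by simp
  then have nM: "n \<bullet> M = c"
    using nO u by (simp add: inner_diff_right)
  define f where "f = (1 / norm n) *\<^sub>R n"
  have "f \<bullet> f = 1"
    using n by (simp add: f_def power2_norm_eq_inner[symmetric] power2_eq_square)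
  moreover have "u \<bullet> f = 0"
    using nu by (simp add: f_def inner_commute)
  moreover have "(X - M) \<bullet> f > 0" if "X \<in> H" for X
    using that n nM by (simp add: Hc f_def inner_commute[of _ n] inner_diff_right)
  ultimately show thesis
    by (rule that)
qed

lemma norm_orthonormal_sq:
  fixes u f :: "'a::real_inner"
  assumes "u \<bullet> u = 1" "f \<bullet> f = 1" "u \<bullet> f = 0"
  shows "(norm (a *\<^sub>R u + b *\<^sub>R f))\<^sup>2 = a\<^sup>2 + b\<^sup>2"
  unfolding power2_norm_eq_inner
  using assms by (simp add: inner_add_left inner_add_right inner_commute[of f u] power2_eq_square)

section \<open>The twin and the tangent to the sibling\<close>

text \<open>The contact point of the circle with the line is the foot of the perpendicular from
  its center, so the coordinate of the center along \<open>u\<close> is the radius up to sign. The sign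
  is positive because the point diametrically opposite to the contact point and the point
  \<open>M + R *\<^sub>R u\<close> are on the same side of the line.\<close>

lemma tangent_circle_axis_coordinate:
  fixes w M u :: point
  assumes u: "u \<bullet> u = 1" and R: "R > 0"
    and l: "l = {X. (X - M) \<bullet> u = 0}"
    and K: "closed_half_plane l K" "M + R *\<^sub>R u \<in> K" "sphere w r \<subseteq> K"
    and tan: "line_tangent_at l w r T" and r: "r > 0"
  shows "(w - M) \<bullet> u = r"
proof -
  define a where "a = (w - M) \<bullet> u"
  define F where "F = w - a *\<^sub>R u"
  have T: "T \<in> l" "norm (T - w) = r"
    using tan by (auto simp: line_tangent_at_def set_eq_iff dist_norm norm_minus_commute)
  have F: "F \<in> l"
    using u by (simp add: l F_def a_def inner_diff_left)
  have "(T - w) \<bullet> (F - T) = 0"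
    using tan F by (rule line_tangent_at_perp)
  moreover have "(F - w) \<bullet> (F - T) = 0"
  proof -
    have "u \<bullet> (F - T) = 0"
      using F T by (simp add: l inner_diff_left inner_commute[of u])
    then show ?thesis
      by (simp add: F_def)
  qed
  ultimately have "((F - w) - (T - w)) \<bullet> (F - T) = 0"
    by (simp only: inner_diff_left[of "F - w"])
  then have "F - T = 0"
    by simp
  then have FT: "T = w - a *\<^sub>R u"
    by (simp add: F_def)
  have "norm u = 1"
    using u by (simp add: norm_eq_1)
  then have abs: "\<bar>a\<bar> = r"
    using T by (simp add: FT)
  obtain n c where n: "l = {X. n \<bullet> X = c}" "K = {X. n \<bullet> X \<ge> c}"
    using K(1) by (auto simp: closed_half_plane_def)
  have "M \<in> l" "M + u \<notin> l"
    using u by (auto simp: l)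
  then have nM: "n \<bullet> M = c" "n \<bullet> u \<noteq> 0"
    by (auto simp: n inner_add_right)
  have "R * (n \<bullet> u) \<ge> 0"
    using K(2) nM by (simp add: n inner_add_right)
  then have nu: "n \<bullet> u > 0"
    using R nM by (simp add: zero_le_mult_iff)
  have "w + a *\<^sub>R u \<in> sphere w r"
    using abs \<open>norm u = 1\<close> by (simp add: dist_norm)
  then have "n \<bullet> (w + a *\<^sub>R u) \<ge> c"
    using K(3) n by auto
  moreover have "n \<bullet> (w - a *\<^sub>R u) = c"
    using T(1) by (simp add: n FT)
  ultimately have "a * (n \<bullet> u) \<ge> 0"
    by (simp add: inner_add_right inner_diff_right)
  then have "a \<ge> 0"
    using nu by (simp add: zero_le_mult_iff)
  then have "a = r"
    using abs by linarith
  then show ?thesis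
    by (simp only: a_def)
qed

text \<open>With center \<open>(r, y)\<close>, tangency to the internal circle gives \<open>y\<^sup>2 = 4 r R2\<close>; after
  substituting this, tangency to the external circle is linear in \<open>r\<close>.\<close>

lemma twin_coordinates:
  fixes w M u f :: point
  assumes frame: "u \<bullet> u = 1" "f \<bullet> f = 1" "u \<bullet> f = 0"
    and R: "R1 > 0" "R2 > 0"
    and twin: "is_twin {X. (X - M) \<bullet> u = 0} H (M + R2 *\<^sub>R u) R2
        (M + (R2 - R1) *\<^sub>R u) (R1 + R2) w r"
  shows "(w - M) \<bullet> u = R1 * R2 / (R1 + R2)"
    and "((w - M) \<bullet> f)\<^sup>2 = 4 * R1 * R2\<^sup>2 / (R1 + R2)"
proof -
  define y where "y = (w - M) \<bullet> f"
  have r: "r > 0"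
    and K: "\<exists>K. closed_half_plane {X. (X - M) \<bullet> u = 0} K \<and> M + R2 *\<^sub>R u \<in> K \<and> sphere w r \<subseteq> K"
    and tan: "\<exists>T. line_tangent_at {X. (X - M) \<bullet> u = 0} w r T"
    and ext: "\<exists>T. ext_tangent_at w r (M + R2 *\<^sub>R u) R2 T"
    and int: "\<exists>T. int_tangent_at w r (M + (R2 - R1) *\<^sub>R u) (R1 + R2) T"
    using twin by (auto simp: is_twin_def)
  have wu: "(w - M) \<bullet> u = r"
    using tangent_circle_axis_coordinate[OF frame(1) R(2) refl] K tan r by blast
  have wM: "w - M = r *\<^sub>R u + y *\<^sub>R f"
    using orthonormal_expansion_plane[OF frame, of "w - M"] by (simp add: wu y_def)
  have d: "(dist w (M + a *\<^sub>R u))\<^sup>2 = (r - a)\<^sup>2 + y\<^sup>2" for a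
  proof -
    have "w - (M + a *\<^sub>R u) = (r - a) *\<^sub>R u + y *\<^sub>R f"
      using wM by (simp add: algebra_simps)
    then show ?thesis
      using norm_orthonormal_sq[OF frame] by (simp add: dist_norm)
  qed
  have "dist w (M + R2 *\<^sub>R u) = r + R2"
    using ext ext_tangent_at_dist r R by blast
  then have "(r - R2)\<^sup>2 + y\<^sup>2 = (r + R2)\<^sup>2"
    using d[of R2] by simp
  then have y: "y\<^sup>2 = 4 * r * R2"
    by (simp add: power2_eq_square algebra_simps)
  have "dist w (M + (R2 - R1) *\<^sub>R u) = R1 + R2 - r"
    using int int_tangent_at_dist r by blast
  then have "(r - (R2 - R1))\<^sup>2 + y\<^sup>2 = (R1 + R2 - r)\<^sup>2"
    using d[of "R2 - R1"] by simp
  then have "r * (R1 + R2) = R1 * R2"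
    unfolding y by (simp add: power2_eq_square algebra_simps)
  then have r_eq: "r = R1 * R2 / (R1 + R2)"
    using R by (simp add: field_simps)
  show "(w - M) \<bullet> u = R1 * R2 / (R1 + R2)"
    unfolding wu by (rule r_eq)
  show "((w - M) \<bullet> f)\<^sup>2 = 4 * R1 * R2\<^sup>2 / (R1 + R2)"
    unfolding y_def[symmetric] y r_eq by (simp add: power2_eq_square)
qed

text \<open>The contact point \<open>T\<close> lies on the sibling, and on the circle with diameter \<open>O1 S\<close>,
  where \<open>S\<close> is the center of the sibling. The difference of the two equations is linear in
  the first coordinate of \<open>T\<close>. The coordinates are taken relative to \<open>S\<close>, since
  \<open>T - S\<close> is the vector that is compared with the twin.\<close>

lemma sibling_contact_coordinates:
  fixes T M u f S :: point
  assumes frame: "u \<bullet> u = 1" "f \<bullet> f = 1" "u \<bullet> f = 0"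
    and R: "R1 > 0" "R2 > 0"
    and S: "S = M + (R2 / 2) *\<^sub>R u"
    and dist: "norm (T - S) = R2 / 2"
    and perp: "(T - S) \<bullet> (M - R1 *\<^sub>R u - T) = 0"
  shows "(T - S) \<bullet> u = - (R2\<^sup>2 / (2 * (2 * R1 + R2)))"
    and "((T - S) \<bullet> f)\<^sup>2 = R1 * R2\<^sup>2 * (R1 + R2) / (2 * R1 + R2)\<^sup>2"
proof -
  define p where "p = (T - S) \<bullet> u"
  define q where "q = (T - S) \<bullet> f"
  have TS: "T - S = p *\<^sub>R u + q *\<^sub>R f"
    using orthonormal_expansion_plane[OF frame, of "T - S"] by (simp add: p_def q_def)
  have sq: "p\<^sup>2 + q\<^sup>2 = (R2 / 2)\<^sup>2"
    unfolding norm_orthonormal_sq[OF frame, symmetric] TS[symmetric] dist by (rule refl)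
  have "M - R1 *\<^sub>R u - T = - ((R1 + R2 / 2) *\<^sub>R u) - (T - S)"
    by (simp add: S algebra_simps)
  then have "(T - S) \<bullet> (M - R1 *\<^sub>R u - T) = - ((R1 + R2 / 2) * p) - (norm (T - S))\<^sup>2"
    by (simp only: inner_diff_right inner_minus_right inner_scaleR_right p_def
        power2_norm_eq_inner)
  then have "(R1 + R2 / 2) * p = - (R2 / 2)\<^sup>2"
    using perp dist by simp
  then have p: "p = - (R2\<^sup>2 / (2 * (2 * R1 + R2)))"
    using R by (simp add: field_simps power2_eq_square)
  then show "(T - S) \<bullet> u = - (R2\<^sup>2 / (2 * (2 * R1 + R2)))"
    by (simp add: p_def)
  have "q\<^sup>2 = (R2 / 2)\<^sup>2 - (R2\<^sup>2 / (2 * (2 * R1 + R2)))\<^sup>2"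
    using sq p by simp
  also have "\<dots> = R1 * R2\<^sup>2 * (R1 + R2) / (2 * R1 + R2)\<^sup>2"
  proof -
    have "2 * R1 + R2 \<noteq> 0"
      using R by simp
    then show ?thesis
      by (simp add: divide_simps) (simp add: power2_eq_square power4_eq_xxxx algebra_simps)
  qed
  finally show "((T - S) \<bullet> f)\<^sup>2 = R1 * R2\<^sup>2 * (R1 + R2) / (2 * R1 + R2)\<^sup>2"
    by (simp add: q_def)
qed

text \<open>The homothety with center \<open>A\<close> and ratio \<open>k\<close> takes the tangent circle with center
  \<open>S\<close> to one with center \<open>\<Omega>\<close> that is tangent to the same line, so it takes the contact
  point \<open>T\<close> to the projection of \<open>\<Omega>\<close>.\<close>

lemma is_pole_by_homothety:
  assumes tan: "line_tangent_at t S d T" and A: "A \<in> t"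
    and k: "k > 0" and m: "m > 0" and d: "d > 0"
    and \<Omega>: "\<Omega> = A + k *\<^sub>R (S - A)" and D: "D = \<Omega> + m *\<^sub>R (T - S)"
    and prod: "k * m * d\<^sup>2 = \<rho>\<^sup>2"
  shows "is_pole \<Omega> \<rho> t D"
proof -
  define P where "P = A + k *\<^sub>R (T - A)"
  have line: "is_line t" and T: "T \<in> t" "norm (T - S) = d"
    using tan by (auto simp: line_tangent_at_def set_eq_iff dist_norm norm_minus_commute)
  have P: "P \<in> t"
    unfolding P_def using is_line_affine[OF line] A T by (intro affine_point_on_line)
  have PO: "P - \<Omega> = k *\<^sub>R (T - S)"
    by (simp add: P_def \<Omega> algebra_simps)
  have perp: "(\<Omega> - P) \<bullet> (X - P) = 0" if "X \<in> t" for X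
  proof -
    have "(T - S) \<bullet> (X - P) = (T - S) \<bullet> (X - T) - (T - S) \<bullet> (P - T)"
      by (simp add: inner_diff_right)
    also have "\<dots> = 0"
      using line_tangent_at_perp[OF tan] that P by simp
    finally show ?thesis
      using PO by (metis inner_minus_left inner_scaleR_left minus_diff_eq mult_zero_right neg_0_equal_iff_equal)
  qed
  have distP: "dist \<Omega> P = k * d"
    using PO T k by (simp add: dist_norm norm_minus_commute)
  have "\<Omega> \<notin> t"
  proof
    assume "\<Omega> \<in> t"
    then have "\<Omega> = P"
      using perp[of \<Omega>] by simp
    then show False
      using distP k d by simp
  qed
  moreover have "D = \<Omega> + (m / k) *\<^sub>R (P - \<Omega>)"
    using k by (simp add: PO D)
  moreover have "dist \<Omega> P * dist \<Omega> D = \<rho>\<^sup>2"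
  proof -
    have "dist \<Omega> D = m * d"
      using T m by (simp add: D dist_norm)
    then show ?thesis
      unfolding distP prod[symmetric] by (simp add: power2_eq_square)
  qed
  moreover have "m / k \<ge> 0"
    using k m by simp
  ultimately show ?thesis
    unfolding is_pole_def using line P perp
    by (intro conjI bexI[of _ P] exI[of _ "m / k"] ballI)
qed

lemma twin_center_is_pole:
  assumes arb: "arbelos O1 R1 O2 R2 M C A1 A2"
    and H: "open_half_plane (affine hull {O1, O2}) H"
    and t: "tangent_from_to_diam_circle t O1 O2 M T" and TH: "T \<in> H"
    and twin: "is_twin (perp_line M O1 O2) H O2 R2 C (R1 + R2) w r"
  shows "is_pole O2 R2 t w"
proof -
  have R: "R1 > 0" "R2 > 0"
    using arb by (auto simp: arbelos_def)
  obtain u where u: "norm u = 1" "O1 = M - R1 *\<^sub>R u" "O2 = M + R2 *\<^sub>R u"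
    "C = M + (R2 - R1) *\<^sub>R u"
    using arb by (rule arbelos_axis)
  obtain f where f: "f \<bullet> f = 1" "u \<bullet> f = 0" and pos: "\<And>X. X \<in> H \<Longrightarrow> (X - M) \<bullet> f > 0"
    using half_plane_normal[OF H u(1-3) R] by blast
  have frame: "u \<bullet> u = 1" "f \<bullet> f = 1" "u \<bullet> f = 0"
    using u f by (simp_all add: norm_eq_1)
  define S where "S = M + (R2 / 2) *\<^sub>R u"
  have mid: "midpoint O2 M = S"
    by (simp add: midpoint_def S_def u vec_eq_iff)
  have "dist O2 M = R2"
    using u R by (simp add: dist_norm)
  then have tan: "line_tangent_at t S (R2 / 2) T" and O1t: "O1 \<in> t"
    using t mid by (auto simp: tangent_from_to_diam_circle_def)
  have dT: "norm (T - S) = R2 / 2"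
    using tan by (auto simp: line_tangent_at_def set_eq_iff dist_norm norm_minus_commute)
  have "(T - S) \<bullet> (M - R1 *\<^sub>R u - T) = 0"
    using line_tangent_at_perp[OF tan O1t] u by simp
  note Tco = sibling_contact_coordinates[OF frame R S_def dT this]
  have l: "perp_line M O1 O2 = {X. (X - M) \<bullet> u = 0}"
  proof -
    have "O2 - O1 = (R1 + R2) *\<^sub>R u"
      by (simp add: u algebra_simps)
    then show ?thesis
      using R by (simp add: perp_line_def)
  qed
  have twin': "is_twin {X. (X - M) \<bullet> u = 0} H (M + R2 *\<^sub>R u) R2
      (M + (R2 - R1) *\<^sub>R u) (R1 + R2) w r"
    using twin l u by simp
  note wco = twin_coordinates[OF frame R twin']
  \<comment> \<open>The ratio \<open>k\<close> is \<open>O1 O2 / O1 S\<close>, and \<open>m\<close> is \<open>O2 w / S T\<close>, where \<open>O2 w = r + R2\<close>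
    by the tangency of the twin to the internal circle.\<close>
  define k where "k = 2 * (R1 + R2) / (2 * R1 + R2)"
  define m where "m = 2 * (2 * R1 + R2) / (R1 + R2)"
  have nz: "R1 + R2 \<noteq> 0" "2 * R1 + R2 \<noteq> 0"
    using R by auto
  have "2 * a / b * (2 * b / a) = 4" if "a \<noteq> 0" "b \<noteq> 0" for a b :: real
    using that by simp
  from this[OF nz] have "k * m = 4"
    by (simp only: k_def m_def)
  then have km: "k > 0" "m > 0" "k * m = 4"
    using R by (simp_all add: k_def m_def)
  have xco: "(w - O2) \<bullet> u = m * ((T - S) \<bullet> u)"
  proof -
    have "(w - O2) \<bullet> u = R1 * R2 / (R1 + R2) - R2"
      using wco(1) frame by (simp add: u inner_diff_left inner_add_left)
    also have "\<dots> = m * ((T - S) \<bullet> u)"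
      unfolding Tco(1) m_def using nz by (simp add: divide_simps) (simp add: power2_eq_square algebra_simps)
    finally show ?thesis .
  qed
  have yco: "(w - O2) \<bullet> f = m * ((T - S) \<bullet> f)"
  proof -
    have wf: "(w - O2) \<bullet> f = (w - M) \<bullet> f" and Tf: "(T - S) \<bullet> f = (T - M) \<bullet> f"
      using frame by (simp_all add: u S_def inner_diff_left inner_add_left)
    have "((w - O2) \<bullet> f)\<^sup>2 = m\<^sup>2 * ((T - S) \<bullet> f)\<^sup>2"
      unfolding Tco(2) wf wco(2) m_def
      using nz by (simp add: divide_simps power_divide power_mult_distrib) (simp add: power2_eq_square algebra_simps)
    then have "((w - O2) \<bullet> f)\<^sup>2 = (m * ((T - S) \<bullet> f))\<^sup>2"
      by (simp add: power_mult_distrib)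
    moreover have "(w - O2) \<bullet> f > 0" "(T - S) \<bullet> f > 0"
      unfolding wf Tf using pos TH twin by (auto simp: is_twin_def)
    ultimately show ?thesis
      using km by (simp add: power2_eq_iff_nonneg)
  qed
  have "w - O2 = (m * ((T - S) \<bullet> u)) *\<^sub>R u + (m * ((T - S) \<bullet> f)) *\<^sub>R f"
    using orthonormal_expansion_plane[OF frame, of "w - O2"] xco yco by simp
  also have "\<dots> = m *\<^sub>R (((T - S) \<bullet> u) *\<^sub>R u + ((T - S) \<bullet> f) *\<^sub>R f)"
    by (simp add: scaleR_add_right)
  also have "\<dots> = m *\<^sub>R (T - S)"
    using orthonormal_expansion_plane[OF frame, of "T - S"] by simp
  finally have w: "w = O2 + m *\<^sub>R (T - S)"
    by (simp add: algebra_simps)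
  have "k * (R1 + R2 / 2) = R1 + R2"
    using nz by (simp add: k_def divide_simps) (simp add: algebra_simps)
  moreover have "S - O1 = (R1 + R2 / 2) *\<^sub>R u"
    by (simp add: S_def u algebra_simps)
  ultimately have "k *\<^sub>R (S - O1) = (R1 + R2) *\<^sub>R u"
    by simp
  then have "O2 = O1 + k *\<^sub>R (S - O1)"
    by (simp add: u algebra_simps)
  moreover have "k * m * (R2 / 2)\<^sup>2 = R2\<^sup>2"
    by (simp add: km power2_eq_square)
  ultimately show ?thesis
    using is_pole_by_homothety[OF tan O1t km(1,2)] R w by simp
qed

theorem theorem1:
  fixes O1 O2 M C A1 A2 T1 T2 w1 w2 :: point
    and R1 R2 r1 r2 :: real
    and H t1 t2 :: "point set"
  assumes "arbelos O1 R1 O2 R2 M C A1 A2"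
    and "open_half_plane (affine hull {O1, O2}) H"
    and "tangent_from_to_diam_circle t2 O1 O2 M T2" and "T2 \<in> H"
    and "tangent_from_to_diam_circle t1 O2 O1 M T1" and "T1 \<in> H"
    and "is_twin (perp_line M O1 O2) H O1 R1 C (R1 + R2) w1 r1"
    and "is_twin (perp_line M O1 O2) H O2 R2 C (R1 + R2) w2 r2"
  shows "is_pole O2 R2 t2 w2 \<and> is_pole O1 R1 t1 w1"
proof
  show "is_pole O2 R2 t2 w2"
    using assms by (intro twin_center_is_pole)
  have "perp_line M O1 O2 = perp_line M O2 O1"
    by (auto simp: perp_line_def inner_diff_right)
  then have "is_twin (perp_line M O2 O1) H O1 R1 C (R2 + R1) w1 r1"
    using assms(7) by (simp add: add.commute)
  moreover have "open_half_plane (affine hull {O2, O1}) H"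
    using assms(2) by (simp add: insert_commute)
  ultimately show "is_pole O1 R1 t1 w1"
    using twin_center_is_pole[OF arbelos_swap[OF assms(1)]] assms(5,6) by blast
qed

end
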